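(* Let $G$ be a connected graph that is $K_4$-UH, is not the line graph of any simple graph, and is the edge-disjoint union of subgraphs isomorphic to $K_4$. Let $H=G\,\square\,G$ be the Cartesian square of $G$. Then: (a) $H$ is connected; (b) $H$ is not a line graph; (c) $H$ is the edge-disjoint union of subgraphs isomorphic to $K_4$; (d) $H$ is $K_4$-UH.
   Context: A graph $G$ is $K_4$-UH if every isomorphism between two induced subgraphs of $G$ isomorphic to $K_4$ extends to an automorphism of $G$. The Cartesian product $G\,\square\,G$ has vertex set $V(G)\times V(G)$, with $(u,v)$ adjacent to $(u',v')$ iff either $u=u'$ and $vv'\in E(G)$, or $v=v'$ and $uu'\in E(G)$. *)

theory Defs
  imports "Graph_Theory.Graph_Theory"
begin

text \<open>
  A simple undirected graph is a loopless symmetric digraph without parallel arcs, that is, a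
  \<^locale>\<open>pair_bidirected_digraph\<close>; the undirected edge \<open>uv\<close> is the pair of arcs
  \<open>(u, v)\<close>, \<open>(v, u)\<close>. Neither finiteness nor non-emptiness is built in, but the library
  notion \<^const>\<open>Digraph_Component.connected\<close> excludes the null graph.
\<close>

definition graph_isomorphism ::
    "('a \<Rightarrow> 'b) \<Rightarrow> 'a pair_pre_digraph \<Rightarrow> 'b pair_pre_digraph \<Rightarrow> bool" where
  "graph_isomorphism f G H \<longleftrightarrow>
     bij_betw f (pverts G) (pverts H) \<and>
     (\<forall>u\<in>pverts G. \<forall>v\<in>pverts G. (u, v) \<in> parcs G \<longleftrightarrow> (f u, f v) \<in> parcs H)"

definition K4_UH :: "'a pair_pre_digraph \<Rightarrow> bool" where
  "K4_UH G \<longleftrightarrow>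
     (\<forall>A B f.
        induced_subgraph (with_proj A) (with_proj G) \<and> K\<^bsub>4\<^esub> (with_proj A) \<and>
        induced_subgraph (with_proj B) (with_proj G) \<and> K\<^bsub>4\<^esub> (with_proj B) \<and>
        graph_isomorphism f A B \<longrightarrow>
        (\<exists>g. graph_isomorphism g G G \<and> (\<forall>x\<in>pverts A. g x = f x)))"

definition edge_disjoint_union_K4 :: "'a pair_pre_digraph \<Rightarrow> bool" where
  "edge_disjoint_union_K4 G \<longleftrightarrow>
     (\<exists>\<K>.
        (\<forall>K\<in>\<K>. subgraph (with_proj K) (with_proj G) \<and> K\<^bsub>4\<^esub> (with_proj K)) \<and>
        pairwise (\<lambda>K L. parcs K \<inter> parcs L = {}) \<K> \<and>
        pverts G = (\<Union>K\<in>\<K>. pverts K) \<and>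
        parcs G = (\<Union>K\<in>\<K>. parcs K))"

definition cartesian_product ::
    "'a pair_pre_digraph \<Rightarrow> 'b pair_pre_digraph \<Rightarrow> ('a \<times> 'b) pair_pre_digraph"
    (infixl \<open>\<box>\<close> 70) where
  "G \<box> H = \<lparr> pverts = pverts G \<times> pverts H,
     parcs = {((u, v), (u', v')) | u v u' v'.
       (u = u' \<and> u \<in> pverts G \<and> (v, v') \<in> parcs H) \<or>
       (v = v' \<and> v \<in> pverts H \<and> (u, u') \<in> parcs G)} \<rparr>"

definition line_graph :: "'a pair_pre_digraph \<Rightarrow> 'a set pair_pre_digraph" where
  "line_graph F = \<lparr> pverts = {{u, v} | u v. (u, v) \<in> parcs F},
     parcs = {({u, v}, {x, y}) | u v x y. (u, v) \<in> parcs F \<and> (x, y) \<in> parcs F \<and>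
       {u, v} \<noteq> {x, y} \<and> {u, v} \<inter> {x, y} \<noteq> {}} \<rparr>"

text \<open>
  HOL cannot quantify over the vertex type of the root graph \<open>F\<close>. The type \<open>'a \<times> bool\<close>
  loses nothing: the vertices of \<open>G\<close> are the edges of \<open>F\<close>, so the non-isolated vertices
  of \<open>F\<close> are at most two for each vertex of \<open>G\<close>, and isolated vertices do not affect
  \<open>line_graph F\<close>. Lemma \<open>is_line_graphI\<close> below proves that a root graph over an
  arbitrary type suffices.
\<close>

definition is_line_graph :: "'a pair_pre_digraph \<Rightarrow> bool" where
  "is_line_graph G \<longleftrightarrow>
     (\<exists>F :: ('a \<times> bool) pair_pre_digraph.
        pair_bidirected_digraph F \<and> digraph_iso (with_proj (line_graph F)) (with_proj G))"

lemma pair_bidirected_digraph_iff: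
  "pair_bidirected_digraph G \<longleftrightarrow>
     (\<forall>u v. (u, v) \<in> parcs G \<longrightarrow>
        u \<in> pverts G \<and> v \<in> pverts G \<and> u \<noteq> v \<and> (v, u) \<in> parcs G)"
  unfolding pair_bidirected_digraph_def pair_sym_digraph_def pair_loopfree_digraph_def
    pair_wf_digraph_def pair_sym_digraph_axioms_def pair_loopfree_digraph_axioms_def
    symmetric_def sym_def
  by auto

lemma pair_bidirected_digraph_cartesian_product:
  assumes "pair_bidirected_digraph G" "pair_bidirected_digraph H"
  shows "pair_bidirected_digraph (G \<box> H)"
  using assms unfolding pair_bidirected_digraph_iff cartesian_product_def by auto

lemma pair_bidirected_digraph_line_graph: "pair_bidirected_digraph (line_graph F)"
  unfolding pair_bidirected_digraph_iff line_graph_def by (auto; blast)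

lemma digraph_iso_iff_graph_isomorphism:
  assumes "pair_wf_digraph G" "pair_wf_digraph H"
  shows "digraph_iso (with_proj G) (with_proj H) \<longleftrightarrow> (\<exists>f. graph_isomorphism f G H)"
proof
  assume "digraph_iso (with_proj G) (with_proj H)"
  then obtain h where h: "pre_digraph.digraph_isomorphism (with_proj G) h" "with_proj H = app_iso h (with_proj G)"
    unfolding digraph_iso_def by blast
  have V: "pverts H = iso_verts h ` pverts G" and A: "parcs H = iso_arcs h ` parcs G"
    and T: "iso_tail h = fst" and D: "iso_head h = snd"
    using arg_cong[OF h(2), of verts] arg_cong[OF h(2), of arcs]
      arg_cong[OF h(2), of tail] arg_cong[OF h(2), of head] by simp_all
  have inj: "inj_on (iso_verts h) (pverts G)"
    and ar: "\<And>a. a \<in> parcs G \<Longrightarrow> iso_arcs h a = (iso_verts h (fst a), iso_verts h (snd a))"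
    using h(1) T D unfolding pre_digraph.digraph_isomorphism_def by (auto simp: prod_eq_iff)
  have "(u, v) \<in> parcs G \<longleftrightarrow> (iso_verts h u, iso_verts h v) \<in> parcs H"
    if uv: "u \<in> pverts G" "v \<in> pverts G" for u v
  proof
    assume "(u, v) \<in> parcs G"
    with ar[OF this] show "(iso_verts h u, iso_verts h v) \<in> parcs H"
      unfolding A by force
  next
    assume "(iso_verts h u, iso_verts h v) \<in> parcs H"
    then obtain x y where xy: "(x, y) \<in> parcs G"
      and e: "iso_arcs h (x, y) = (iso_verts h u, iso_verts h v)"
      unfolding A by force
    have "x \<in> pverts G" "y \<in> pverts G"
      using xy pair_wf_digraph.in_arcsD1[OF assms(1)] pair_wf_digraph.in_arcsD2[OF assms(1)]
      by auto
    with ar[OF xy] e uv inj have "x = u" "y = v" by (auto dest: inj_onD)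
    with xy show "(u, v) \<in> parcs G" by simp
  qed
  with inj V show "\<exists>f. graph_isomorphism f G H"
    unfolding graph_isomorphism_def bij_betw_def by blast
next
  assume "\<exists>f. graph_isomorphism f G H"
  then obtain f where f: "inj_on f (pverts G)" "pverts H = f ` pverts G"
    and fa: "\<And>u v. u \<in> pverts G \<Longrightarrow> v \<in> pverts G \<Longrightarrow>
      (u, v) \<in> parcs G \<longleftrightarrow> (f u, f v) \<in> parcs H"
    unfolding graph_isomorphism_def bij_betw_def by blast
  have wG: "\<And>u v. (u, v) \<in> parcs G \<Longrightarrow> u \<in> pverts G \<and> v \<in> pverts G"
    using pair_wf_digraph.in_arcsD1[OF assms(1)] pair_wf_digraph.in_arcsD2[OF assms(1)] by blast
  have wH: "\<And>u v. (u, v) \<in> parcs H \<Longrightarrow> u \<in> pverts H \<and> v \<in> pverts H"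
    using pair_wf_digraph.in_arcsD1[OF assms(2)] pair_wf_digraph.in_arcsD2[OF assms(2)] by blast
  define h where "h = \<lparr> iso_verts = f, iso_arcs = map_prod f f, iso_head = snd, iso_tail = fst \<rparr>"
  have A: "parcs H = map_prod f f ` parcs G"
  proof (intro equalityI subrelI)
    fix a b assume ab: "(a, b) \<in> parcs H"
    with wH f(2) obtain u v where "u \<in> pverts G" "v \<in> pverts G" "a = f u" "b = f v" by blast
    with fa ab show "(a, b) \<in> map_prod f f ` parcs G" by force
  qed (use fa wG in auto)
  have "inj_on (map_prod f f) (parcs G)"
    using f(1) wG by (auto simp: inj_on_def)
  moreover have "wf_digraph (with_proj G)"
    using assms(1) by (simp add: wf_digraph_wp_iff)
  ultimately have "pre_digraph.digraph_isomorphism (with_proj G) h"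
    using f(1) unfolding pre_digraph.digraph_isomorphism_def h_def by simp
  moreover have "with_proj H = app_iso h (with_proj G)"
    unfolding app_iso_def h_def with_proj_def using f(2) A by simp
  ultimately show "digraph_iso (with_proj G) (with_proj H)"
    unfolding digraph_iso_def by blast
qed

lemma is_line_graphI:
  fixes F :: "'b pair_pre_digraph" and G :: "'a pair_pre_digraph"
  assumes F: "pair_bidirected_digraph F" and G: "pair_wf_digraph G"
    and iso: "digraph_iso (with_proj (line_graph F)) (with_proj G)"
  shows "is_line_graph G"
proof -
  have simpF: "\<And>u v. (u, v) \<in> parcs F \<Longrightarrow> u \<noteq> v \<and> (v, u) \<in> parcs F"
    using F unfolding pair_bidirected_digraph_iff by blast
  have wfL: "pair_wf_digraph (line_graph K)" for K :: "'k pair_pre_digraph"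
    using pair_bidirected_digraph_line_graph[of K]
    by (simp add: pair_bidirected_digraph_def pair_sym_digraph_def)
  obtain \<phi> where \<phi>: "bij_betw \<phi> (pverts (line_graph F)) (pverts G)"
    using iso digraph_iso_iff_graph_isomorphism[OF wfL G] unfolding graph_isomorphism_def by blast
  have "\<forall>x\<in>pverts G. \<exists>p q. (p, q) \<in> parcs F \<and> \<phi> {p, q} = x"
    using bij_betw_imp_surj_on[OF \<phi>, symmetric] by (auto simp: line_graph_def)
  then obtain p q where pq: "\<And>x. x \<in> pverts G \<Longrightarrow> (p x, q x) \<in> parcs F \<and> \<phi> {p x, q x} = x"
    by metis
  define r where "r = (\<lambda>(x, b). if b then p x else q x)"
  define S :: "('a \<times> bool) set" where "S = pverts G \<times> UNIV"
  define W where "W = {w. \<exists>z. (w, z) \<in> parcs F}"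
  have WS: "W \<subseteq> r ` S"
  proof
    fix w assume "w \<in> W"
    then obtain z where wz: "(w, z) \<in> parcs F" unfolding W_def by blast
    then have L: "{w, z} \<in> pverts (line_graph F)" unfolding line_graph_def by auto
    define x where "x = \<phi> {w, z}"
    have x: "x \<in> pverts G" using L \<phi> unfolding x_def bij_betw_def by blast
    have "{p x, q x} \<in> pverts (line_graph F)"
      using pq[OF x] unfolding line_graph_def by auto
    with L pq[OF x] \<phi> have "{p x, q x} = {w, z}"
      unfolding x_def bij_betw_def by (metis inj_onD)
    then have "w = p x \<or> w = q x" by blast
    moreover have "p x = r (x, True)" "q x = r (x, False)" unfolding r_def by auto
    ultimately show "w \<in> r ` S" using x unfolding S_def by blast
  qed
  define j where "j = inv_into S r"
  have j: "inj_on j W" unfolding j_def using WS by (rule inj_on_inv_into)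
  define F' where "F' = \<lparr> pverts = j ` W, parcs = map_prod j j ` parcs F \<rparr>"
  have inW: "u \<in> W" "v \<in> W" if "(u, v) \<in> parcs F" for u v
    using that simpF unfolding W_def by blast+
  have F': "pair_bidirected_digraph F'"
    unfolding pair_bidirected_digraph_iff
  proof (intro allI impI)
    fix a b assume "(a, b) \<in> parcs F'"
    then obtain u v where uv: "(u, v) \<in> parcs F" and ab: "a = j u" "b = j v"
      unfolding F'_def by auto
    have "a \<noteq> b" using simpF[OF uv] inW[OF uv] j unfolding ab by (auto dest: inj_onD)
    moreover have "(b, a) \<in> parcs F'"
      using simpF[OF uv] unfolding ab F'_def by (auto intro!: image_eqI[where x = "(v, u)"])
    ultimately show "a \<in> pverts F' \<and> b \<in> pverts F' \<and> a \<noteq> b \<and> (b, a) \<in> parcs F'"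
      using inW[OF uv] unfolding ab F'_def by simp
  qed
  have subW: "e \<subseteq> W" if "e \<in> pverts (line_graph F)" for e
    using that inW unfolding line_graph_def by auto
  have arcs_L: "(d, e) \<in> parcs (line_graph K) \<longleftrightarrow>
      d \<in> pverts (line_graph K) \<and> e \<in> pverts (line_graph K) \<and> d \<noteq> e \<and> d \<inter> e \<noteq> {}"
    for K :: "'k pair_pre_digraph" and d e
    unfolding line_graph_def by (simp; blast)
  have im: "pverts (line_graph F') = (`) j ` pverts (line_graph F)"
  proof -
    have "pverts (line_graph K) = (\<lambda>(u, v). {u, v}) ` parcs K" for K :: "'k pair_pre_digraph"
      unfolding line_graph_def by auto
    note L = this
    show ?thesis unfolding L by (auto simp: F'_def image_image split_beta)
  qed
  have "graph_isomorphism ((`) j) (line_graph F) (line_graph F')"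
    unfolding graph_isomorphism_def
  proof (intro conjI ballI)
    show "bij_betw ((`) j) (pverts (line_graph F)) (pverts (line_graph F'))"
      unfolding bij_betw_def im
      using inj_on_image_Pow[OF j] subW by (auto intro: inj_on_subset)
  next
    fix d e assume de: "d \<in> pverts (line_graph F)" "e \<in> pverts (line_graph F)"
    have "j ` d = j ` e \<longleftrightarrow> d = e" using inj_on_image_eq_iff[OF j] subW de by blast
    moreover have "j ` d \<inter> j ` e = j ` (d \<inter> e)"
      using inj_on_image_Int[OF j] subW de by blast
    ultimately show "(d, e) \<in> parcs (line_graph F) \<longleftrightarrow> (j ` d, j ` e) \<in> parcs (line_graph F')"
      unfolding arcs_L im using de by auto
  qed
  then have "digraph_iso (with_proj (line_graph F)) (with_proj (line_graph F'))"
    using digraph_iso_iff_graph_isomorphism[OF wfL wfL] by blast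
  then have "digraph_iso (with_proj (line_graph F')) (with_proj (line_graph F))"
    using digraph_iso_swap wfL wf_digraph_wp_iff by blast
  then have "digraph_iso (with_proj (line_graph F')) (with_proj G)"
    using iso by (rule digraph_iso_trans)
  with F' show ?thesis unfolding is_line_graph_def by blast
qed

end

theory Submission
  imports Defs
begin

text \<open>
  Every clique of \<open>G \<box> H\<close> lies in a single layer \<open>{u} \<times> H\<close> or \<open>G \<times> {v}\<close>, because adjacent
  vertices agree in exactly one coordinate. Hence the layers carry the \<open>K\<^sub>4\<close>-decompositions, and
  after composing with the coordinate swap an isomorphism between two \<open>K\<^sub>4\<close>s of \<open>G \<box> G\<close> maps
  \<open>{u} \<times> S\<close> to \<open>{u'} \<times> T\<close>. It extends to a product of two automorphisms of \<open>G\<close>: one extending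
  \<open>S \<rightarrow> T\<close>, and one taking \<open>u\<close> to \<open>u'\<close>, which exists because \<open>G\<close> is vertex-transitive: every
  vertex lies in a \<open>K\<^sub>4\<close>. A layer is an induced copy of \<open>G\<close>, and induced subgraphs of line
  graphs are line graphs, so \<open>G \<box> G\<close> is not a line graph.
\<close>

section \<open>Four-cliques as vertex sets\<close>

text \<open>
  A \<open>K\<^sub>4\<close> in a simple graph is determined by its vertex set, so both notions of the
  theorem can be phrased with sets of four pairwise adjacent vertices.
\<close>

definition is_K4 :: "'a pair_pre_digraph \<Rightarrow> 'a set \<Rightarrow> bool" where
  "is_K4 G S \<longleftrightarrow> S \<subseteq> pverts G \<and> card S = 4 \<and>
     (\<forall>x\<in>S. \<forall>y\<in>S. x \<noteq> y \<longrightarrow> (x, y) \<in> parcs G)"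

definition complete_graph :: "'a set \<Rightarrow> 'a pair_pre_digraph" where
  "complete_graph S = \<lparr> pverts = S, parcs = {(x, y). x \<in> S \<and> y \<in> S \<and> x \<noteq> y} \<rparr>"

lemma complete_graph_simps [simp]:
  "pverts (complete_graph S) = S"
  "(x, y) \<in> parcs (complete_graph S) \<longleftrightarrow> x \<in> S \<and> y \<in> S \<and> x \<noteq> y"
  by (simp_all add: complete_graph_def)

lemma K4_iff:
  "K\<^bsub>4\<^esub> (with_proj A) \<longleftrightarrow> card (pverts A) = 4 \<and> A = complete_graph (pverts A)"
proof -
  \<comment> \<open>An infinite set has \<open>card\<close> 0, so cardinality 4 already forces the
    finiteness that is part of being a complete digraph.\<close>
  have "finite (pverts A)" if "card (pverts A) = 4"
    using that card_gt_0_iff[of "pverts A"] by simp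
  then show ?thesis
    unfolding complete_digraph_pair_def complete_graph_def
    by (cases A) auto
qed

lemma subgraph_with_proj_iff:
  "subgraph (with_proj A) (with_proj G) \<longleftrightarrow>
     pverts A \<subseteq> pverts G \<and> parcs A \<subseteq> parcs G \<and> pair_wf_digraph G \<and> pair_wf_digraph A"
  by (auto simp: subgraph_def compatible_def wf_digraph_wp_iff)

lemma pair_wf_complete_graph: "pair_wf_digraph (complete_graph S)"
  by unfold_locales auto

lemma pair_bidirected_wf: "pair_bidirected_digraph G \<Longrightarrow> pair_wf_digraph G"
  by (simp add: pair_bidirected_digraph_def pair_sym_digraph_def)

lemma K4_subgraph_iff:
  assumes "pair_wf_digraph G"
  shows "subgraph (with_proj A) (with_proj G) \<and> K\<^bsub>4\<^esub> (with_proj A) \<longleftrightarrow>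
    is_K4 G (pverts A) \<and> A = complete_graph (pverts A)"
proof -
  have "parcs (complete_graph S) \<subseteq> parcs G \<longleftrightarrow>
      (\<forall>x\<in>S. \<forall>y\<in>S. x \<noteq> y \<longrightarrow> (x, y) \<in> parcs G)" for S
    by auto
  then show ?thesis
    unfolding K4_iff subgraph_with_proj_iff is_K4_def
    using assms pair_wf_complete_graph[of "pverts A"] by metis
qed

text \<open>In a loopless graph a clique leaves no room for further arcs between its vertices, so
  for a \<open>K\<^sub>4\<close> being a subgraph and being an induced subgraph coincide.\<close>

lemma K4_induced_subgraph_iff:
  assumes "pair_bidirected_digraph G"
  shows "induced_subgraph (with_proj A) (with_proj G) \<and> K\<^bsub>4\<^esub> (with_proj A) \<longleftrightarrow>
    is_K4 G (pverts A) \<and> A = complete_graph (pverts A)"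
proof -
  have "parcs (complete_graph S) = {e \<in> parcs G. fst e \<in> S \<and> snd e \<in> S}" if "is_K4 G S" for S
  proof -
    have "(x, y) \<in> parcs G \<Longrightarrow> x \<noteq> y" for x y
      using assms unfolding pair_bidirected_digraph_iff by blast
    then show ?thesis
      using that unfolding is_K4_def complete_graph_def by auto
  qed
  then have "parcs A = {e \<in> parcs G. fst e \<in> pverts A \<and> snd e \<in> pverts A}"
    if "is_K4 G (pverts A)" "A = complete_graph (pverts A)"
    using that(1) arg_cong[OF that(2), of parcs] by simp
  moreover have "induced_subgraph (with_proj A) (with_proj G) \<longleftrightarrow>
      subgraph (with_proj A) (with_proj G) \<and>
      parcs A = {e \<in> parcs G. fst e \<in> pverts A \<and> snd e \<in> pverts A}"
    by (simp add: induced_subgraph_def)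
  ultimately show ?thesis
    using K4_subgraph_iff[OF pair_bidirected_wf[OF assms], of A] by argo
qed

text \<open>Adjacency in a complete graph is distinctness, which every bijection preserves and
  reflects.\<close>

lemma graph_isomorphism_complete_graph:
  "graph_isomorphism f (complete_graph S) (complete_graph T) \<longleftrightarrow> bij_betw f S T"
  unfolding graph_isomorphism_def bij_betw_def inj_on_def by auto

lemma K4_UH_iff:
  assumes "pair_bidirected_digraph G"
  shows "K4_UH G \<longleftrightarrow>
    (\<forall>S f. is_K4 G S \<longrightarrow> is_K4 G (f ` S) \<longrightarrow>
      (\<exists>g. graph_isomorphism g G G \<and> (\<forall>x\<in>S. g x = f x)))" (is "_ \<longleftrightarrow> ?R")
proof -
  have bij: "bij_betw f S (f ` S)" if "is_K4 G S" "is_K4 G (f ` S)" for f S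
  proof -
    have "finite S" "card (f ` S) = card S"
      using that card_gt_0_iff[of S] unfolding is_K4_def by auto
    then show ?thesis by (simp add: bij_betw_def eq_card_imp_inj_on)
  qed
  have "K4_UH G \<longleftrightarrow>
    (\<forall>A B f. (is_K4 G (pverts A) \<and> A = complete_graph (pverts A)) \<and>
        (is_K4 G (pverts B) \<and> B = complete_graph (pverts B)) \<and>
        graph_isomorphism f A B \<longrightarrow>
        (\<exists>g. graph_isomorphism g G G \<and> (\<forall>x\<in>pverts A. g x = f x)))"
    unfolding K4_UH_def K4_induced_subgraph_iff[OF assms, symmetric] by simp
  also have "\<dots> \<longleftrightarrow> (\<forall>S T f. is_K4 G S \<and> is_K4 G T \<and> bij_betw f S T \<longrightarrow>
        (\<exists>g. graph_isomorphism g G G \<and> (\<forall>x\<in>S. g x = f x)))"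
    (is "?A \<longleftrightarrow> ?B")
  proof (intro iffI allI impI)
    fix S T f
    assume ?A and "is_K4 G S \<and> is_K4 G T \<and> bij_betw f S T"
    then show "\<exists>g. graph_isomorphism g G G \<and> (\<forall>x\<in>S. g x = f x)"
      using \<open>?A\<close>[rule_format, of "complete_graph S" "complete_graph T" f]
      by (simp add: graph_isomorphism_complete_graph)
  next
    fix A B f
    assume ?B and AB: "(is_K4 G (pverts A) \<and> A = complete_graph (pverts A)) \<and>
      (is_K4 G (pverts B) \<and> B = complete_graph (pverts B)) \<and> graph_isomorphism f A B"
    have "bij_betw f (pverts A) (pverts B)"
      using AB unfolding graph_isomorphism_def by blast
    then show "\<exists>g. graph_isomorphism g G G \<and> (\<forall>x\<in>pverts A. g x = f x)"
      using \<open>?B\<close> AB by blast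
  qed
  also have "\<dots> \<longleftrightarrow> ?R"
  proof (intro iffI allI impI)
    fix S f
    assume all: "\<forall>S T f. is_K4 G S \<and> is_K4 G T \<and> bij_betw f S T \<longrightarrow>
        (\<exists>g. graph_isomorphism g G G \<and> (\<forall>x\<in>S. g x = f x))"
      and "is_K4 G S" "is_K4 G (f ` S)"
    with bij show "\<exists>g. graph_isomorphism g G G \<and> (\<forall>x\<in>S. g x = f x)" by blast
  next
    fix S T f
    assume R: ?R and "is_K4 G S \<and> is_K4 G T \<and> bij_betw f S T"
    then have "is_K4 G S" "is_K4 G (f ` S)" by (auto simp: bij_betw_def)
    with R show "\<exists>g. graph_isomorphism g G G \<and> (\<forall>x\<in>S. g x = f x)" by blast
  qed
  finally show ?thesis .
qed

text \<open>Two complete graphs share an arc exactly when their vertex sets share two distinct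
  vertices. A decomposition is thus a family of 4-cliques, any two different ones meeting in at most
  one vertex, that covers all vertices and arcs; the reverse inclusions of the covering are
  contained in \<open>is_K4\<close>.\<close>

lemma edge_disjoint_union_K4_iff:
  assumes "pair_wf_digraph G"
  shows "edge_disjoint_union_K4 G \<longleftrightarrow>
    (\<exists>\<S>. (\<forall>S\<in>\<S>. is_K4 G S) \<and>
      (\<forall>S\<in>\<S>. \<forall>T\<in>\<S>. \<forall>x\<in>S \<inter> T. \<forall>y\<in>S \<inter> T. x \<noteq> y \<longrightarrow> S = T) \<and>
      pverts G \<subseteq> \<Union>\<S> \<and> (\<forall>x y. (x, y) \<in> parcs G \<longrightarrow> x \<noteq> y \<and> (\<exists>S\<in>\<S>. x \<in> S \<and> y \<in> S)))"
    (is "_ \<longleftrightarrow> (\<exists>\<S>. ?P \<S>)")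
proof
  assume "edge_disjoint_union_K4 G"
  then obtain \<K> where \<K>: "\<forall>K\<in>\<K>. is_K4 G (pverts K) \<and> K = complete_graph (pverts K)"
    and dis: "pairwise (\<lambda>K L. parcs K \<inter> parcs L = {}) \<K>"
    and V: "pverts G = (\<Union>K\<in>\<K>. pverts K)" and A: "parcs G = (\<Union>K\<in>\<K>. parcs K)"
    unfolding edge_disjoint_union_K4_def K4_subgraph_iff[OF assms] by blast
  have arc: "(x, y) \<in> parcs K \<longleftrightarrow> x \<in> pverts K \<and> y \<in> pverts K \<and> x \<noteq> y" if "K \<in> \<K>" for K x y
    using \<K> that complete_graph_simps(2) by metis
  have uniq: "K = L" if "K \<in> \<K>" "L \<in> \<K>" "x \<in> pverts K \<inter> pverts L" "y \<in> pverts K \<inter> pverts L" "x \<noteq> y"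
    for K L x y
    using dis that arc[of K x y] arc[of L x y] unfolding pairwise_def by blast
  have "?P (pverts ` \<K>)"
  proof (intro conjI)
    show "\<forall>S\<in>pverts ` \<K>. \<forall>T\<in>pverts ` \<K>. \<forall>x\<in>S \<inter> T. \<forall>y\<in>S \<inter> T. x \<noteq> y \<longrightarrow> S = T"
      using uniq by blast
    show "\<forall>x y. (x, y) \<in> parcs G \<longrightarrow> x \<noteq> y \<and> (\<exists>S\<in>pverts ` \<K>. x \<in> S \<and> y \<in> S)"
      unfolding A using arc by blast
  qed (use \<K> V in auto)
  then show "\<exists>\<S>. ?P \<S>" by blast
next
  assume "\<exists>\<S>. ?P \<S>"
  then obtain \<S> where \<S>: "?P \<S>" by blast
  have "(x, y) \<in> parcs G \<longleftrightarrow> (\<exists>S\<in>\<S>. x \<in> S \<and> y \<in> S \<and> x \<noteq> y)" for x y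
  proof
    assume "(x, y) \<in> parcs G"
    then show "\<exists>S\<in>\<S>. x \<in> S \<and> y \<in> S \<and> x \<noteq> y" using \<S> by blast
  next
    assume "\<exists>S\<in>\<S>. x \<in> S \<and> y \<in> S \<and> x \<noteq> y"
    then obtain S where "S \<in> \<S>" "x \<in> S" "y \<in> S" "x \<noteq> y" by blast
    moreover from this have "is_K4 G S" using \<S> by blast
    ultimately show "(x, y) \<in> parcs G" unfolding is_K4_def by blast
  qed
  then have A: "parcs G = (\<Union>K\<in>complete_graph ` \<S>. parcs K)"
    by (auto simp: set_eq_iff)
  show "edge_disjoint_union_K4 G"
    unfolding edge_disjoint_union_K4_def K4_subgraph_iff[OF assms]
  proof (intro exI[of _ "complete_graph ` \<S>"] conjI)
    show "pairwise (\<lambda>K L. parcs K \<inter> parcs L = {}) (complete_graph ` \<S>)"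
      using \<S> unfolding pairwise_def by fastforce
    show "pverts G = (\<Union>K\<in>complete_graph ` \<S>. pverts K)"
      using \<S> unfolding is_K4_def by auto
  qed (use \<S> A in auto)
qed

section \<open>Cartesian products\<close>

lemma cartesian_product_simps [simp]:
  "pverts (G \<box> H) = pverts G \<times> pverts H"
  "((u, v), (u', v')) \<in> parcs (G \<box> H) \<longleftrightarrow>
     (u = u' \<and> u \<in> pverts G \<and> (v, v') \<in> parcs H) \<or>
     (v = v' \<and> v \<in> pverts H \<and> (u, u') \<in> parcs G)"
  by (auto simp: cartesian_product_def)

section \<open>Connectedness of Cartesian products\<close>

text \<open>Connectedness is strong connectedness of the symmetric closure; the arcs are already
  symmetric, so passing to the closure does not change reachability.\<close>

lemma connected_iff_reachable:
  assumes "pair_bidirected_digraph G"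
  shows "Digraph_Component.connected (with_proj G) \<longleftrightarrow>
    pverts G \<noteq> {} \<and> (\<forall>u\<in>pverts G. \<forall>v\<in>pverts G. u \<rightarrow>\<^sup>*\<^bsub>with_proj G\<^esub> v)"
proof -
  interpret pair_bidirected_digraph G by (rule assms)
  have "symmetric (with_proj G)" by (rule sym_arcs)
  then show ?thesis
    unfolding Digraph_Component.connected_def strongly_connected_def
    by (simp add: reachable_mk_symmetric_eq)
qed

text \<open>To get from \<open>(u, v)\<close> to \<open>(u', v')\<close>, first walk to
  \<open>(u, v')\<close> with the first coordinate fixed, then to \<open>(u', v')\<close> with the
  second one fixed.\<close>

lemma connected_cartesian_product:
  assumes G: "pair_bidirected_digraph G" "Digraph_Component.connected (with_proj G)"
    and H: "pair_bidirected_digraph H" "Digraph_Component.connected (with_proj H)"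
  shows "Digraph_Component.connected (with_proj (G \<box> H))"
proof -
  note GH = pair_bidirected_digraph_cartesian_product[OF G(1) H(1)]
  interpret G: pair_bidirected_digraph G by (rule G)
  interpret H: pair_bidirected_digraph H by (rule H)
  interpret GH: pair_bidirected_digraph "G \<box> H" by (rule GH)
  have row: "(u, v) \<rightarrow>\<^sup>*\<^bsub>with_proj (G \<box> H)\<^esub> (u, v')"
    if "v \<rightarrow>\<^sup>*\<^bsub>with_proj H\<^esub> v'" "u \<in> pverts G" for u v v'
    using that
  proof (induction rule: H.converse_reachable_induct)
    case (step x y)
    then show ?case by (intro GH.adj_reachable_trans[of "(u, x)" "(u, y)"]) auto
  qed auto
  have col: "(u, v) \<rightarrow>\<^sup>*\<^bsub>with_proj (G \<box> H)\<^esub> (u', v)"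
    if "u \<rightarrow>\<^sup>*\<^bsub>with_proj G\<^esub> u'" "v \<in> pverts H" for u u' v
    using that
  proof (induction rule: G.converse_reachable_induct)
    case (step x y)
    then show ?case by (intro GH.adj_reachable_trans[of "(x, v)" "(y, v)"]) auto
  qed auto
  show ?thesis
    using G H unfolding connected_iff_reachable[OF GH] connected_iff_reachable[OF G(1)]
      connected_iff_reachable[OF H(1)]
    by (auto intro: GH.reachable_trans[OF row col])
qed

section \<open>Cliques and clique decompositions of Cartesian products\<close>

text \<open>Distinct vertices of a layer differ in its free coordinate, so only arcs of that factor
  can join them.\<close>

lemma is_K4_layer:
  shows "u \<in> pverts G \<Longrightarrow> is_K4 (G \<box> H) ({u} \<times> T) \<longleftrightarrow> is_K4 H T"
    and "v \<in> pverts H \<Longrightarrow> is_K4 (G \<box> H) (S \<times> {v}) \<longleftrightarrow> is_K4 G S"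
  unfolding is_K4_def by (auto simp: card_cartesian_product)

lemma is_K4_nonempty: "is_K4 G S \<Longrightarrow> S \<noteq> {}"
  unfolding is_K4_def by auto

lemma is_K4_cartesian_product_cases:
  assumes "is_K4 (G \<box> H) S"
  obtains (row) u T where "u \<in> pverts G" "is_K4 H T" "S = {u} \<times> T"
    | (col) v T where "v \<in> pverts H" "is_K4 G T" "S = T \<times> {v}"
proof -
  obtain a b where ab: "(a, b) \<in> S" using is_K4_nonempty[OF assms] by auto
  then have V: "a \<in> pverts G" "b \<in> pverts H" using assms unfolding is_K4_def by auto
  have adj: "x = x' \<or> y = y'" if "(x, y) \<in> S" "(x', y') \<in> S" for x y x' y'
    using assms that unfolding is_K4_def by fastforce
  show ?thesis
  proof (cases "\<forall>(x, y)\<in>S. x = a")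
    case True
    then have "S = {a} \<times> snd ` S" by force
    then show ?thesis using row V assms is_K4_layer(1) by metis
  next
    case False
    \<comment> \<open>Some vertex has a first coordinate \<open>c\<close> other than
      \<open>a\<close>; comparison with \<open>(a, b)\<close> forces its second coordinate to be
      \<open>b\<close>.\<close>
    then obtain c where "(c, b) \<in> S" "c \<noteq> a" using adj[OF ab] by blast
    \<comment> \<open>A vertex \<open>(x, y)\<close> with \<open>y \<noteq> b\<close> would need
      both \<open>x = a\<close> and \<open>x = c\<close>, by comparison with \<open>(a, b)\<close>
      and \<open>(c, b)\<close>.\<close>
    then have "\<forall>(x, y)\<in>S. y = b" using adj ab by blast
    then have "S = fst ` S \<times> {b}" by force
    then show ?thesis using col V assms is_K4_layer(2) by metis
  qed
qed

lemma edge_disjoint_union_K4_cartesian_product: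
  assumes G: "pair_wf_digraph G" "edge_disjoint_union_K4 G"
    and H: "pair_wf_digraph H" "edge_disjoint_union_K4 H"
  shows "edge_disjoint_union_K4 (G \<box> H)"
proof -
  obtain \<S> where S: "\<forall>S\<in>\<S>. is_K4 G S" "pverts G \<subseteq> \<Union>\<S>"
    "\<forall>S\<in>\<S>. \<forall>T\<in>\<S>. \<forall>x\<in>S \<inter> T. \<forall>y\<in>S \<inter> T. x \<noteq> y \<longrightarrow> S = T"
    "\<forall>x y. (x, y) \<in> parcs G \<longrightarrow> x \<noteq> y \<and> (\<exists>S\<in>\<S>. x \<in> S \<and> y \<in> S)"
    using G unfolding edge_disjoint_union_K4_iff[OF G(1)] by blast
  obtain \<T> where T: "\<forall>S\<in>\<T>. is_K4 H S" "pverts H \<subseteq> \<Union>\<T>"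
    "\<forall>S\<in>\<T>. \<forall>T\<in>\<T>. \<forall>x\<in>S \<inter> T. \<forall>y\<in>S \<inter> T. x \<noteq> y \<longrightarrow> S = T"
    "\<forall>x y. (x, y) \<in> parcs H \<longrightarrow> x \<noteq> y \<and> (\<exists>S\<in>\<T>. x \<in> S \<and> y \<in> S)"
    using H unfolding edge_disjoint_union_K4_iff[OF H(1)] by blast
  have GH: "pair_wf_digraph (G \<box> H)"
    using G(1) H(1) unfolding pair_wf_digraph_def by (auto simp: cartesian_product_def)
  \<comment> \<open>A copy of the decomposition of \<open>H\<close> goes into every layer
    \<open>{u} \<times> H\<close> and a copy of that of \<open>G\<close> into every layer
    \<open>G \<times> {v}\<close>; each arc of the product lies in one such layer.\<close>
  define \<R> where "\<R> = {{u} \<times> T | u T. u \<in> pverts G \<and> T \<in> \<T>}"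
  define \<C> where "\<C> = {S \<times> {v} | v S. v \<in> pverts H \<and> S \<in> \<S>}"
  have R: "{u} \<times> T \<in> \<R>" if "u \<in> pverts G" "T \<in> \<T>" for u T
    using that unfolding \<R>_def by blast
  have C: "S \<times> {v} \<in> \<C>" if "v \<in> pverts H" "S \<in> \<S>" for v S
    using that unfolding \<C>_def by blast
  show ?thesis
    unfolding edge_disjoint_union_K4_iff[OF GH]
  proof (intro exI[of _ "\<R> \<union> \<C>"] conjI)
    show "\<forall>K\<in>\<R> \<union> \<C>. is_K4 (G \<box> H) K"
      using S(1) T(1) by (auto simp: \<R>_def \<C>_def is_K4_layer)
    \<comment> \<open>A row block \<open>{u} \<times> T\<close> and a column block
      \<open>S \<times> {v}\<close> meet at most in \<open>(u, v)\<close>. Blocks of the same kind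
      that meet lie in the same layer, which reduces them to the decomposition of the
      factor.\<close>
    have "p = q" if "A \<in> \<R>" "B \<in> \<C>" "p \<in> A \<inter> B" "q \<in> A \<inter> B" for A B p q
      using that unfolding \<R>_def \<C>_def by auto
    moreover have "A = B"
      if "A \<in> \<R>" "B \<in> \<R>" "p \<in> A \<inter> B" "q \<in> A \<inter> B" "p \<noteq> q" for A B p q
      using that T(3) unfolding \<R>_def by auto
    moreover have "A = B"
      if "A \<in> \<C>" "B \<in> \<C>" "p \<in> A \<inter> B" "q \<in> A \<inter> B" "p \<noteq> q" for A B p q
      using that S(3) unfolding \<C>_def by auto
    ultimately show "\<forall>K\<in>\<R> \<union> \<C>. \<forall>L\<in>\<R> \<union> \<C>. \<forall>x\<in>K \<inter> L. \<forall>y\<in>K \<inter> L. x \<noteq> y \<longrightarrow> K = L"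
      by (metis IntI IntE Un_iff)
    show "pverts (G \<box> H) \<subseteq> \<Union>(\<R> \<union> \<C>)"
    proof
      fix p assume "p \<in> pverts (G \<box> H)"
      then obtain u v where p: "p = (u, v)" "u \<in> pverts G" "v \<in> pverts H" by auto
      then obtain T where "T \<in> \<T>" "v \<in> T" using T(2) by blast
      then show "p \<in> \<Union>(\<R> \<union> \<C>)" using R[OF p(2)] p(1) by blast
    qed
    show "\<forall>p q. (p, q) \<in> parcs (G \<box> H) \<longrightarrow> p \<noteq> q \<and> (\<exists>K\<in>\<R> \<union> \<C>. p \<in> K \<and> q \<in> K)"
    proof (intro allI impI)
      fix p q assume pq: "(p, q) \<in> parcs (G \<box> H)"
      obtain u v u' v' where e: "p = (u, v)" "q = (u', v')" by (metis surj_pair)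
      with pq consider "u = u'" "u \<in> pverts G" "(v, v') \<in> parcs H"
        | "v = v'" "v \<in> pverts H" "(u, u') \<in> parcs G"
        by auto
      then show "p \<noteq> q \<and> (\<exists>K\<in>\<R> \<union> \<C>. p \<in> K \<and> q \<in> K)"
      proof cases
        case 1
        then obtain T where "T \<in> \<T>" "v \<in> T" "v' \<in> T" "v \<noteq> v'" using T(4) by blast
        then show ?thesis
          using R[OF 1(2)] e 1(1) by (intro conjI bexI[of _ "{u} \<times> T"]) simp_all
      next
        case 2
        then obtain S where "S \<in> \<S>" "u \<in> S" "u' \<in> S" "u \<noteq> u'" using S(4) by blast
        then show ?thesis
          using C[OF 2(2)] e 2(1) by (intro conjI bexI[of _ "S \<times> {v}"]) simp_all
      qed
    qed
  qed
qed

section \<open>Line graphs\<close>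

lemma line_graph_verts_iff:
  "e \<in> pverts (line_graph F) \<longleftrightarrow> (\<exists>x y. e = {x, y} \<and> (x, y) \<in> parcs F)"
  unfolding line_graph_def by auto

lemma line_graph_arcs_iff:
  "(d, e) \<in> parcs (line_graph F) \<longleftrightarrow>
    d \<in> pverts (line_graph F) \<and> e \<in> pverts (line_graph F) \<and> d \<noteq> e \<and> d \<inter> e \<noteq> {}"
  unfolding line_graph_def by (simp; blast)

text \<open>The map \<open>f\<close> embeds \<open>G\<close> as an induced subgraph of
  \<open>H\<close>. Deleting vertices from a line graph amounts to deleting edges from its root
  graph, so a root of \<open>G\<close> arises from a root of \<open>H\<close> by discarding
  edges.\<close>

lemma is_line_graph_induced:
  fixes f :: "'a \<Rightarrow> 'b"
  assumes G: "pair_wf_digraph G" and H: "pair_wf_digraph H" "is_line_graph H"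
    and f: "inj_on f (pverts G)" "f ` pverts G \<subseteq> pverts H"
    and arcs: "\<And>u v. u \<in> pverts G \<Longrightarrow> v \<in> pverts G \<Longrightarrow>
      (u, v) \<in> parcs G \<longleftrightarrow> (f u, f v) \<in> parcs H"
  shows "is_line_graph G"
proof -
  have wfL: "pair_wf_digraph (line_graph K)" for K :: "'k pair_pre_digraph"
    by (rule pair_bidirected_wf[OF pair_bidirected_digraph_line_graph])
  obtain F :: "('b \<times> bool) pair_pre_digraph" and \<phi> where F: "pair_bidirected_digraph F"
    and \<phi>: "graph_isomorphism \<phi> (line_graph F) H"
    using H unfolding is_line_graph_def digraph_iso_iff_graph_isomorphism[OF wfL H(1)] by blast
  \<comment> \<open>Only the edges of \<open>F\<close> that correspond to vertices in the image of
    \<open>f\<close> are kept. The condition depends on the unordered pair, so \<open>F'\<close>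
    stays symmetric.\<close>
  define F' where "F' = \<lparr> pverts = pverts F, parcs = {(x, y) \<in> parcs F. \<phi> {x, y} \<in> f ` pverts G} \<rparr>"
  have F': "pair_bidirected_digraph F'"
    using F unfolding pair_bidirected_digraph_iff F'_def by (auto simp: insert_commute)
  have "(x, y) \<in> parcs F' \<longleftrightarrow> (x, y) \<in> parcs F \<and> \<phi> {x, y} \<in> f ` pverts G" for x y
    unfolding F'_def by simp
  then have V: "pverts (line_graph F') = {e \<in> pverts (line_graph F). \<phi> e \<in> f ` pverts G}"
    by (intro set_eqI) (simp only: mem_Collect_eq line_graph_verts_iff; blast)
  have inj: "inj_on \<phi> (pverts (line_graph F'))" and im: "\<phi> ` pverts (line_graph F) = pverts H"
    using \<phi> unfolding graph_isomorphism_def bij_betw_def V by (auto intro: inj_on_subset)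
  have "\<phi> ` pverts (line_graph F') = f ` pverts G"
  proof (intro equalityI subsetI)
    fix y assume y: "y \<in> f ` pverts G"
    then have "y \<in> \<phi> ` pverts (line_graph F)" using f(2) im by blast
    then obtain e where "e \<in> pverts (line_graph F)" "y = \<phi> e" ..
    with y show "y \<in> \<phi> ` pverts (line_graph F')" unfolding V by simp
  qed (auto simp: V)
  with inj have "bij_betw \<phi> (pverts (line_graph F')) (f ` pverts G)"
    by (simp add: bij_betw_def)
  moreover have "bij_betw (inv_into (pverts G) f) (f ` pverts G) (pverts G)"
    using f(1) by (simp add: bij_betw_inv_into inj_on_imp_bij_betw)
  ultimately have "bij_betw (inv_into (pverts G) f \<circ> \<phi>) (pverts (line_graph F')) (pverts G)"
    by (rule bij_betw_trans)
  moreover have "(d, e) \<in> parcs (line_graph F') \<longleftrightarrow>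
      (inv_into (pverts G) f (\<phi> d), inv_into (pverts G) f (\<phi> e)) \<in> parcs G"
    if "d \<in> pverts (line_graph F')" "e \<in> pverts (line_graph F')" for d e
  proof -
    \<comment> \<open>Adjacency in a line graph only asks whether two edges share an endpoint, so it
      is unaffected by deleting other edges.\<close>
    have "(d, e) \<in> parcs (line_graph F') \<longleftrightarrow> (d, e) \<in> parcs (line_graph F)"
      using that unfolding line_graph_arcs_iff V by blast
    also have "\<dots> \<longleftrightarrow> (\<phi> d, \<phi> e) \<in> parcs H"
      using that \<phi> unfolding V graph_isomorphism_def by blast
    also have "\<dots> \<longleftrightarrow> (inv_into (pverts G) f (\<phi> d), inv_into (pverts G) f (\<phi> e)) \<in> parcs G"
      using that arcs unfolding V by (simp add: f_inv_into_f inv_into_into)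
    finally show ?thesis .
  qed
  ultimately have "graph_isomorphism (inv_into (pverts G) f \<circ> \<phi>) (line_graph F') G"
    unfolding graph_isomorphism_def by simp
  \<comment> \<open>The vertices of \<open>F'\<close> have type \<open>'b \<times> bool\<close>;
    \<open>is_line_graphI\<close> moves the root graph to the type \<open>'a \<times> bool\<close>
    that the definition demands for \<open>G\<close>.\<close>
  then show ?thesis
    using is_line_graphI[OF F' G] digraph_iso_iff_graph_isomorphism[OF wfL G] by blast
qed

section \<open>Automorphisms of the Cartesian square\<close>

lemma graph_isomorphism_comp:
  assumes "graph_isomorphism f G H" "graph_isomorphism g H K"
  shows "graph_isomorphism (g \<circ> f) G K"
proof -
  have "f x \<in> pverts H" if "x \<in> pverts G" for x
    using assms(1) that unfolding graph_isomorphism_def by (auto dest: bij_betwE)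
  then show ?thesis
    using assms unfolding graph_isomorphism_def by (auto intro: bij_betw_trans)
qed

text \<open>Product adjacency combines adjacency in one coordinate with equality in the other;
  isomorphisms preserve and reflect both, equality by injectivity.\<close>

lemma graph_isomorphism_map_prod:
  assumes "graph_isomorphism g G G'" "graph_isomorphism h H H'"
  shows "graph_isomorphism (map_prod g h) (G \<box> H) (G' \<box> H')"
proof -
  have g: "inj_on g (pverts G)" "g ` pverts G = pverts G'"
    and h: "inj_on h (pverts H)" "h ` pverts H = pverts H'"
    using assms unfolding graph_isomorphism_def bij_betw_def by auto
  have "bij_betw (map_prod g h) (pverts G \<times> pverts H) (pverts G' \<times> pverts H')"
    unfolding bij_betw_def using g h by (auto simp: map_prod_inj_on map_prod_surj_on)
  moreover have "g u = g u' \<longleftrightarrow> u = u'" if "u \<in> pverts G" "u' \<in> pverts G" for u u'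
    using g(1) that by (auto dest: inj_onD)
  moreover have "h u = h u' \<longleftrightarrow> u = u'" if "u \<in> pverts H" "u' \<in> pverts H" for u u'
    using h(1) that by (auto dest: inj_onD)
  ultimately show ?thesis
    using assms g(2) h(2) unfolding graph_isomorphism_def by auto
qed

text \<open>For equal factors this automorphism exchanges rows and columns, so that column cliques
  can be treated as row cliques.\<close>

lemma graph_isomorphism_swap: "graph_isomorphism prod.swap (G \<box> H) (H \<box> G)"
proof -
  have "bij_betw prod.swap (pverts (G \<box> H)) (pverts (H \<box> G))"
    unfolding bij_betw_def by (simp add: product_swap)
  moreover have "(p, q) \<in> parcs (G \<box> H) \<longleftrightarrow> (prod.swap p, prod.swap q) \<in> parcs (H \<box> G)" for p q
    by (cases p; cases q) (simp; blast)
  ultimately show ?thesis unfolding graph_isomorphism_def by blast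
qed

lemma graph_isomorphism_id: "graph_isomorphism id G G"
  by (simp add: graph_isomorphism_def)

section \<open>Extending isomorphisms between cliques\<close>

lemma K4_UH_transitive:
  assumes G: "pair_bidirected_digraph G" "K4_UH G" "edge_disjoint_union_K4 G"
    and uv: "u \<in> pverts G" "v \<in> pverts G"
  obtains g where "graph_isomorphism g G G" "g u = v"
proof -
  obtain \<S> where \<S>: "\<forall>S\<in>\<S>. is_K4 G S" "pverts G \<subseteq> \<Union>\<S>"
    using G(3) unfolding edge_disjoint_union_K4_iff[OF pair_bidirected_wf[OF G(1)]]
    by (elim exE conjE)
  with uv obtain S T where S: "is_K4 G S" "u \<in> S" and T: "is_K4 G T" "v \<in> T"
    by (meson UnionE subsetD)
  have "finite S" "finite T" "card S = card T"
    using S(1) T(1) card_gt_0_iff[of S] card_gt_0_iff[of T] unfolding is_K4_def by auto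
  \<comment> \<open>Any bijection between the three remaining vertices of each clique, completed by
    \<open>u \<mapsto> v\<close>, is an isomorphism of cliques that the hypothesis extends.\<close>
  then have "card (S - {u}) = card (T - {v})" using S T by simp
  then obtain f where f: "bij_betw f (S - {u}) (T - {v})"
    using finite_same_card_bij \<open>finite S\<close> \<open>finite T\<close> by blast
  have "f(u := v) ` S = T"
  proof -
    have "f(u := v) ` S = insert v (f ` (S - {u}))" using S(2) by auto
    also have "\<dots> = T" using f T(2) unfolding bij_betw_def by auto
    finally show ?thesis .
  qed
  then obtain g where "graph_isomorphism g G G" "\<forall>x\<in>S. g x = (f(u := v)) x"
    using G(2) S T unfolding K4_UH_iff[OF G(1)] by blast
  with that S(2) show ?thesis by simp
qed

lemma K4_UH_cartesian_square:
  assumes G: "pair_bidirected_digraph G" "K4_UH G" "edge_disjoint_union_K4 G"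
  shows "K4_UH (G \<box> G)"
proof -
  have layer: "\<exists>g. graph_isomorphism g (G \<box> G) (G \<box> G) \<and> (\<forall>p\<in>{u} \<times> S. g p = f p)"
    if K: "u \<in> pverts G" "is_K4 G S" "u' \<in> pverts G" "is_K4 G T" "f ` ({u} \<times> S) = {u'} \<times> T"
    for u u' S T f
  proof -
    \<comment> \<open>The factor \<open>g\<close> moves layer \<open>u\<close> to layer
      \<open>u'\<close>; the factor \<open>h\<close> below realises the action of \<open>f\<close>
      on the second coordinate.\<close>
    obtain g where g: "graph_isomorphism g G G" "g u = u'"
      using K4_UH_transitive[OF G K(1,3)] .
    have "(\<lambda>y. snd (f (u, y))) ` S = snd ` f ` ({u} \<times> S)" by force
    also have "\<dots> = T" unfolding K(5) by simp
    finally obtain h where h: "graph_isomorphism h G G" "\<forall>y\<in>S. h y = snd (f (u, y))"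
      using G(2) K(2,4) unfolding K4_UH_iff[OF G(1)] by metis
    have "f (u, y) = (u', h y)" if "y \<in> S" for y
      using that K(5) h(2) by (auto simp: prod_eq_iff)
    then have "\<forall>p\<in>{u} \<times> S. map_prod g h p = f p" using g(2) by auto
    then show ?thesis using graph_isomorphism_map_prod[OF g(1) h(1)] by blast
  qed
  \<comment> \<open>Every 4-clique is a row clique up to the identity or the swap. Both are
    involutions, so \<sigma> serves as its own inverse.\<close>
  have norm: "\<exists>\<sigma> u T. graph_isomorphism \<sigma> (G \<box> G) (G \<box> G) \<and> (\<forall>p. \<sigma> (\<sigma> p) = p) \<and>
      u \<in> pverts G \<and> is_K4 G T \<and> S = \<sigma> ` ({u} \<times> T)" if "is_K4 (G \<box> G) S" for S
    using that
  proof (cases rule: is_K4_cartesian_product_cases)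
    case (row u T)
    then show ?thesis
      by (intro exI[of _ id] exI[of _ u] exI[of _ T]) (simp add: graph_isomorphism_id)
  next
    case (col v T)
    then show ?thesis
      by (intro exI[of _ prod.swap] exI[of _ v] exI[of _ T])
        (simp add: graph_isomorphism_swap product_swap)
  qed
  show ?thesis
    unfolding K4_UH_iff[OF pair_bidirected_digraph_cartesian_product[OF G(1) G(1)]]
  proof (intro allI impI)
    fix S and f :: "'a \<times> 'a \<Rightarrow> 'a \<times> 'a"
    assume "is_K4 (G \<box> G) S" "is_K4 (G \<box> G) (f ` S)"
    then obtain \<sigma> u A \<tau> v B where
      \<sigma>: "graph_isomorphism \<sigma> (G \<box> G) (G \<box> G)" "\<And>p. \<sigma> (\<sigma> p) = p"
        "u \<in> pverts G" "is_K4 G A" "S = \<sigma> ` ({u} \<times> A)" and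
      \<tau>: "graph_isomorphism \<tau> (G \<box> G) (G \<box> G)" "\<And>p. \<tau> (\<tau> p) = p"
        "v \<in> pverts G" "is_K4 G B" "f ` S = \<tau> ` ({v} \<times> B)"
      using norm by metis
    \<comment> \<open>Composing \<open>f\<close> with the two normalising involutions gives a map
      between row cliques, to which \<open>layer\<close> applies.\<close>
    have "(\<tau> \<circ> f \<circ> \<sigma>) ` ({u} \<times> A) = \<tau> ` f ` S" by (simp add: \<sigma>(5) image_comp comp_assoc)
    also have "\<dots> = {v} \<times> B" unfolding \<tau>(5) by (simp add: image_image \<tau>(2))
    finally obtain g where g: "graph_isomorphism g (G \<box> G) (G \<box> G)"
      "\<forall>p\<in>{u} \<times> A. g p = (\<tau> \<circ> f \<circ> \<sigma>) p"
      using layer[OF \<sigma>(3,4) \<tau>(3,4)] by blast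
    \<comment> \<open>Composing with \<sigma> and \<tau> again undoes the normalisation: on
      \<open>S\<close> the involutions cancel and \<open>f\<close> remains.\<close>
    have "graph_isomorphism (\<tau> \<circ> (g \<circ> \<sigma>)) (G \<box> G) (G \<box> G)"
      by (rule graph_isomorphism_comp[OF graph_isomorphism_comp[OF \<sigma>(1) g(1)] \<tau>(1)])
    moreover have "(\<tau> \<circ> (g \<circ> \<sigma>)) p = f p" if "p \<in> S" for p
    proof -
      obtain q where "q \<in> {u} \<times> A" "p = \<sigma> q" using \<open>p \<in> S\<close> unfolding \<sigma>(5) by (rule imageE)
      then show ?thesis using g(2)[THEN bspec, of q] by (simp only: comp_apply \<sigma>(2) \<tau>(2))
    qed
    ultimately show "\<exists>g. graph_isomorphism g (G \<box> G) (G \<box> G) \<and> (\<forall>p\<in>S. g p = f p)" by blast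
  qed
qed

theorem theorem9:
  fixes G :: "'a pair_pre_digraph"
  assumes "pair_bidirected_digraph G"
    and "Digraph_Component.connected (with_proj G)"
    and "K4_UH G"
    and "\<not> is_line_graph G"
    and "edge_disjoint_union_K4 G"
  shows "Digraph_Component.connected (with_proj (G \<box> G)) \<and>
    \<not> is_line_graph (G \<box> G) \<and>
    edge_disjoint_union_K4 (G \<box> G) \<and>
    K4_UH (G \<box> G)"
proof (intro conjI notI)
  note wf = pair_bidirected_wf[OF assms(1)]
  show "Digraph_Component.connected (with_proj (G \<box> G))"
    using connected_cartesian_product assms(1,2) by blast
  show "edge_disjoint_union_K4 (G \<box> G)"
    using edge_disjoint_union_K4_cartesian_product wf assms(5) by blast
  show "K4_UH (G \<box> G)" using K4_UH_cartesian_square assms(1,3,5) by blast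
next
  assume L: "is_line_graph (G \<box> G)"
  \<comment> \<open>Connectedness excludes the null graph, so there is a layer
    \<open>{w} \<times> G\<close>.\<close>
  obtain w where w: "w \<in> pverts G"
    using assms(2) unfolding connected_iff_reachable[OF assms(1)] by blast
  \<comment> \<open>A loop at \<open>w\<close> would make each vertex of this layer adjacent to
    itself; its absence makes \<open>Pair w\<close> an embedding of \<open>G\<close> as an induced
    subgraph.\<close>
  have "(w, w) \<notin> parcs G"
    using assms(1) unfolding pair_bidirected_digraph_iff by blast
  then have "is_line_graph G"
    using w by (intro is_line_graph_induced[OF pair_bidirected_wf[OF assms(1)] _ L, of "Pair w"]
        pair_bidirected_wf[OF pair_bidirected_digraph_cartesian_product])
      (auto simp: inj_on_def assms(1))
  with assms(4) show False ..
qed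

end
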